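(* Let $q$ be an odd prime power and let $G=UT_3(\mathbf{F}_q)$ be the group of upper unitriangular $3\times3$ matrices over $\mathbf{F}_q$. Then $$cp_2(G)=\frac{q^2+q-1}{q^3},\quad cp_3(G)=\frac{q^3+q^2-1}{q^5},\quad cp_4(G)=\frac{q^4+q^3-1}{q^7},\quad cp_5(G)=\frac{q^5+q^4-1}{q^9}.$$
   Context: $\mathbf{F}_q$ is the finite field with $q$ elements, $q$ odd. For a finite group $G$ and $k\ge 2$, the commuting probability $cp_k(G)$ is the probability that a uniformly random $k$-tuple of elements of $G$ consists of pairwise commuting elements, i.e. $cp_k(G)=|\{(g_1,\dots,g_k)\in G^k: g_ig_j=g_jg_i\text{ for all }i,j\}|/|G|^k$. *)

theory Defs
  imports
    "HOL-Library.FuncSet"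
    "HOL-Library.Cardinality"
    "HOL-Number_Theory.Prime_Powers"
    "HOL-Algebra.Coset"
    "Jordan_Normal_Form.Matrix"
begin

definition commuting_tuples :: "('g, 'm) monoid_scheme \<Rightarrow> nat \<Rightarrow> (nat \<Rightarrow> 'g) set" where
  "commuting_tuples G k =
     {g \<in> {..<k} \<rightarrow>\<^sub>E carrier G.
        \<forall>i<k. \<forall>j<k. g i \<otimes>\<^bsub>G\<^esub> g j = g j \<otimes>\<^bsub>G\<^esub> g i}"

text \<open>Meaningful for a finite group \<open>G\<close> and \<open>k \<ge> 2\<close>.\<close>
definition commuting_prob :: "nat \<Rightarrow> ('g, 'm) monoid_scheme \<Rightarrow> real" where
  "commuting_prob k G = real (card (commuting_tuples G k)) / real (order G) ^ k"

definition UT :: "nat \<Rightarrow> 'a :: field mat monoid" where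
  "UT n = \<lparr>carrier = {A \<in> carrier_mat n n. upper_triangular A \<and> (\<forall>i<n. A $$ (i, i) = 1)},
           mult = (*),
           one = 1\<^sub>m n\<rparr>"

end

theory Submission
  imports Defs
begin

text \<open>
  Write an element of \<open>UT 3\<close> as \<open>heis a b c\<close>, with \<open>a\<close>, \<open>c\<close> above the diagonal and \<open>b\<close> in the
  corner. The corner entry \<open>b\<close> is central, and two elements commute iff their vectors \<open>(a, c)\<close> and
  \<open>(a', c')\<close> in the plane over the field have vanishing determinant \<open>a c' - a' c\<close>. So a commuting
  \<open>k\<close>-tuple amounts to a free choice of \<open>k\<close> corner entries together with two vectors
  \<open>a = (a\<^sub>0, \<dots>, a\<^sub>k\<^sub>-\<^sub>1)\<close> and \<open>c = (c\<^sub>0, \<dots>, c\<^sub>k\<^sub>-\<^sub>1)\<close> all of whose \<open>2 \<times> 2\<close> minors vanish. For fixed \<open>a\<close>,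
  the vector \<open>c\<close> is arbitrary if \<open>a = 0\<close>, and is one of the \<open>q\<close> multiples of \<open>a\<close> otherwise
  (\<open>card_parallel\<close>). This makes \<open>q ^ k + (q ^ k - 1) q\<close> pairs, hence
  \<open>q ^ k (q ^ k + (q ^ k - 1) q)\<close> commuting tuples, and dividing by \<open>(q ^ 3) ^ k\<close> gives
  the closed form \<open>(q ^ k + q ^ (k - 1) - 1) / q ^ (2 k - 1)\<close> for every \<open>k \<ge> 1\<close>
  (\<open>commuting_prob_UT_3\<close>); the theorem collects its values at \<open>k = 2, 3, 4, 5\<close>.
\<close>

definition heis :: "'a::field \<Rightarrow> 'a \<Rightarrow> 'a \<Rightarrow> 'a mat" where
  "heis a b c = mat 3 3 (\<lambda>(i, j).
     if i = j then 1
     else if i = 0 \<and> j = 1 then a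
     else if i = 0 \<and> j = 2 then b
     else if i = 1 \<and> j = 2 then c
     else 0)"

lemma heis_entries [simp]:
  "heis a b c $$ (0, Suc 0) = a" "heis a b c $$ (0, 2) = b" "heis a b c $$ (Suc 0, 2) = c"
  by (simp_all add: heis_def)

lemma heis_inject: "heis a b c = heis a' b' c' \<longleftrightarrow> a = a' \<and> b = b' \<and> c = c'"
  by (metis heis_entries)

lemma heis_in_carrier: "heis a b c \<in> carrier (UT 3)"
  by (auto simp: UT_def heis_def)

lemma carrier_UT_3_eq_heis:
  assumes "A \<in> carrier (UT 3)"
  shows "A = heis (A $$ (0, 1)) (A $$ (0, 2)) (A $$ (1, 2))"
proof (rule eq_matI)
  have dims: "dim_row A = 3" "dim_col A = 3"
    and lower: "\<And>i j. j < i \<Longrightarrow> i < 3 \<Longrightarrow> A $$ (i, j) = 0"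
    and diag: "\<And>i. i < 3 \<Longrightarrow> A $$ (i, i) = 1"
    using assms by (auto simp: UT_def)
  show "dim_row A = dim_row (heis (A $$ (0, 1)) (A $$ (0, 2)) (A $$ (1, 2)))"
       "dim_col A = dim_col (heis (A $$ (0, 1)) (A $$ (0, 2)) (A $$ (1, 2)))"
    using dims by (simp_all add: heis_def)
  fix i j
  assume "i < dim_row (heis (A $$ (0, 1)) (A $$ (0, 2)) (A $$ (1, 2)))"
     and "j < dim_col (heis (A $$ (0, 1)) (A $$ (0, 2)) (A $$ (1, 2)))"
  then have "i \<in> {0, 1, 2}" "j \<in> {0, 1, 2}"
    by (auto simp: heis_def)
  then show "A $$ (i, j) = heis (A $$ (0, 1)) (A $$ (0, 2)) (A $$ (1, 2)) $$ (i, j)"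
    using lower diag by (auto simp: heis_def)
qed

lemma heis_mult:
  "heis a b c * heis a' b' c' = heis (a + a') (b + b' + a * c') (c + c')"
proof (rule eq_matI)
  fix i j
  assume "i < dim_row (heis (a + a') (b + b' + a * c') (c + c'))"
     and "j < dim_col (heis (a + a') (b + b' + a * c') (c + c'))"
  then have "i \<in> {0, 1, 2}" "j \<in> {0, 1, 2}"
    by (auto simp: heis_def)
  then show "(heis a b c * heis a' b' c') $$ (i, j)
      = heis (a + a') (b + b' + a * c') (c + c') $$ (i, j)"
    by (auto simp: heis_def scalar_prod_def numeral_3_eq_3)
qed (simp_all add: heis_def)

lemma heis_commute_iff:
  "heis a b c \<otimes>\<^bsub>UT 3\<^esub> heis a' b' c' = heis a' b' c' \<otimes>\<^bsub>UT 3\<^esub> heis a b c \<longleftrightarrow> a * c' = a' * c"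
  by (auto simp: UT_def heis_mult heis_inject add.commute)

lemma order_UT_3: "order (UT 3 :: 'a::{field, finite} mat monoid) = CARD('a) ^ 3"
proof -
  let ?f = "\<lambda>(a, b, c). heis a b c :: 'a mat"
  have "carrier (UT 3) = range ?f"
    using carrier_UT_3_eq_heis heis_in_carrier by (fastforce simp: image_def)
  moreover have "inj ?f"
    by (auto simp: inj_def heis_inject)
  ultimately show ?thesis
    by (simp add: order_def card_image power3_eq_cube)
qed

definition parallel :: "nat \<Rightarrow> (nat \<Rightarrow> 'a::field) \<Rightarrow> (nat \<Rightarrow> 'a) set" where
  "parallel k a = {c \<in> {..<k} \<rightarrow>\<^sub>E UNIV. \<forall>i<k. \<forall>j<k. a i * c j = a j * c i}"

text \<open>
  A coordinate \<open>m\<close> with \<open>a m \<noteq> 0\<close> determines the factor \<open>c m / a m\<close>, and the minors involving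
  column \<open>m\<close> force \<open>c\<close> to be that multiple of \<open>a\<close>.
\<close>
lemma card_parallel:
  fixes a :: "nat \<Rightarrow> 'a::{field, finite}"
  shows "card (parallel k a) = (if \<forall>i<k. a i = 0 then CARD('a) ^ k else CARD('a))"
proof (cases "\<forall>i<k. a i = 0")
  case True
  then have "parallel k a = {..<k} \<rightarrow>\<^sub>E UNIV"
    by (auto simp: parallel_def)
  with True show ?thesis
    by (simp add: card_funcsetE)
next
  case False
  then obtain m where m: "m < k" "a m \<noteq> 0" by blast
  let ?f = "\<lambda>t. \<lambda>i\<in>{..<k}. t * a i"
  have "inj ?f"
  proof (rule injI)
    fix s t assume "?f s = ?f t"
    from fun_cong[OF this, of m] show "s = t" using m by simp
  qed
  moreover have "parallel k a = range ?f"
  proof (intro equalityI subsetI)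
    fix c assume c: "c \<in> parallel k a"
    have "c = ?f (c m / a m)"
    proof
      fix i
      show "c i = ?f (c m / a m) i"
      proof (cases "i < k")
        case True
        then have "a m * c i = a i * c m" using c m by (simp add: parallel_def)
        with True m show ?thesis by (simp add: field_simps)
      next
        case False
        then show ?thesis using c by (auto simp: parallel_def PiE_def extensional_def)
      qed
    qed
    then show "c \<in> range ?f" by blast
  next
    fix c assume "c \<in> range ?f"
    then show "c \<in> parallel k a" by (auto simp: parallel_def split: if_splits)
  qed
  ultimately have "card (parallel k a) = CARD('a)"
    by (simp add: card_image)
  then show ?thesis by (simp only: if_not_P[OF False])
qed

lemma card_Sigma_parallel:
  "real (card (SIGMA a:({..<k} \<rightarrow>\<^sub>E (UNIV :: 'a::{field, finite} set)). parallel k a))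
     = real CARD('a) ^ k + (real CARD('a) ^ k - 1) * real CARD('a)"
proof -
  let ?V = "{..<k} \<rightarrow>\<^sub>E (UNIV :: 'a set)"
  let ?z = "\<lambda>i\<in>{..<k}. 0 :: 'a"
  have fin: "finite ?V" by (simp add: finite_PiE)
  have z: "?z \<in> ?V" by simp
  have nonzero: "card (parallel k a) = CARD('a)" if "a \<in> ?V - {?z}" for a
  proof -
    have "\<not> (\<forall>i<k. a i = 0)"
    proof
      assume "\<forall>i<k. a i = 0"
      then have "a = ?z" using that by (intro PiE_ext[of _ "{..<k}" "\<lambda>_. UNIV"]) auto
      with that show False by simp
    qed
    then show ?thesis by (simp only: card_parallel if_False)
  qed
  have "card (SIGMA a:?V. parallel k a) = (\<Sum>a\<in>?V. card (parallel k a))"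
    by (rule card_SigmaI[OF fin]) (auto simp: parallel_def finite_PiE)
  also have "\<dots> = card (parallel k ?z) + (\<Sum>a\<in>?V - {?z}. card (parallel k a))"
    by (rule sum.remove[OF fin z])
  also have "\<dots> = CARD('a) ^ k + (CARD('a) ^ k - 1) * CARD('a)"
    using nonzero fin z by (simp add: card_parallel card_funcsetE)
  finally show ?thesis by (simp add: of_nat_diff)
qed

lemma card_commuting_tuples_UT_3:
  "real (card (commuting_tuples (UT 3 :: 'a::{field, finite} mat monoid) k))
     = real CARD('a) ^ k * (real CARD('a) ^ k + (real CARD('a) ^ k - 1) * real CARD('a))"
proof -
  let ?V = "{..<k} \<rightarrow>\<^sub>E (UNIV :: 'a set)"
  let ?S = "SIGMA a:?V. parallel k a"
  let ?f = "\<lambda>(b, a, c). \<lambda>i\<in>{..<k}. heis (a i) (b i) (c i)"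
  have "bij_betw ?f (?V \<times> ?S) (commuting_tuples (UT 3) k)"
    unfolding bij_betw_def
  proof (intro conjI equalityI subsetI)
    show "inj_on ?f (?V \<times> ?S)"
    proof (rule inj_onI)
      fix x y
      assume "x \<in> ?V \<times> ?S" "y \<in> ?V \<times> ?S" and f_eq: "?f x = ?f y"
      then obtain a b c a' b' c' where xy: "x = (b, a, c)" "y = (b', a', c')"
        and V: "b \<in> ?V" "b' \<in> ?V" "a \<in> ?V" "a' \<in> ?V"
        and P: "c \<in> parallel k a" "c' \<in> parallel k a'"
        by (cases x; cases y) auto
      have eq: "(\<lambda>i\<in>{..<k}. heis (a i) (b i) (c i)) = (\<lambda>i\<in>{..<k}. heis (a' i) (b' i) (c' i))"
        using f_eq by (simp only: xy prod.case)
      have C: "c \<in> ?V" "c' \<in> ?V" using P by (simp_all add: parallel_def)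
      have "a i = a' i \<and> b i = b' i \<and> c i = c' i" if "i < k" for i
        using fun_cong[OF eq, of i] that by (simp add: heis_inject)
      then have "b = b' \<and> a = a' \<and> c = c'"
        using V C by (intro conjI PiE_ext[where k = "{..<k}" and s = "\<lambda>_. UNIV"]) simp_all
      then show "x = y" by (simp add: xy)
    qed
  next
    fix g assume "g \<in> ?f ` (?V \<times> ?S)"
    then show "g \<in> commuting_tuples (UT 3) k"
      by (auto simp: commuting_tuples_def parallel_def heis_in_carrier heis_commute_iff)
  next
    fix g :: "nat \<Rightarrow> 'a mat"
    assume g: "g \<in> commuting_tuples (UT 3) k"
    define entry where "entry p = (\<lambda>i\<in>{..<k}. g i $$ p)" for p
    have g_eq: "g i = heis (entry (0, 1) i) (entry (0, 2) i) (entry (1, 2) i)" if "i < k" for i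
    proof -
      have "g i \<in> carrier (UT 3)" using g that by (auto simp: commuting_tuples_def)
      from carrier_UT_3_eq_heis[OF this] show ?thesis using that by (simp add: entry_def)
    qed
    have entry: "entry p \<in> ?V" for p by (simp add: entry_def)
    have "entry (0, 1) i * entry (1, 2) j = entry (0, 1) j * entry (1, 2) i"
      if "i < k" "j < k" for i j
    proof -
      have "g i \<otimes>\<^bsub>UT 3\<^esub> g j = g j \<otimes>\<^bsub>UT 3\<^esub> g i"
        using g that by (simp add: commuting_tuples_def)
      then show ?thesis
        unfolding g_eq[OF that(1)] g_eq[OF that(2)] heis_commute_iff .
    qed
    then have "(entry (0, 2), entry (0, 1), entry (1, 2)) \<in> ?V \<times> ?S"
      using entry by (simp add: parallel_def)
    moreover have "g = ?f (entry (0, 2), entry (0, 1), entry (1, 2))"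
    proof
      fix i
      show "g i = ?f (entry (0, 2), entry (0, 1), entry (1, 2)) i"
      proof (cases "i < k")
        case True
        then show ?thesis using g_eq by simp
      next
        case False
        then show ?thesis using g by (auto simp: commuting_tuples_def PiE_def extensional_def)
      qed
    qed
    ultimately show "g \<in> ?f ` (?V \<times> ?S)" by (rule rev_image_eqI)
  qed
  then have "card (commuting_tuples (UT 3 :: 'a mat monoid) k) = card (?V \<times> ?S)"
    by (rule bij_betw_same_card[symmetric])
  then show ?thesis
    by (simp only: card_cartesian_product of_nat_mult card_Sigma_parallel)
       (simp add: card_funcsetE)
qed

lemma commuting_prob_UT_3:
  fixes q :: real
  assumes "k \<ge> 1" and q: "q = real CARD('a::{field, finite})"
  shows "commuting_prob k (UT 3 :: 'a mat monoid) = (q ^ k + q ^ (k - 1) - 1) / q ^ (2 * k - 1)"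
proof -
  obtain n where k: "k = Suc n" using assms(1) by (cases k) auto
  have "q \<noteq> 0" using q by simp
  have "commuting_prob k (UT 3 :: 'a mat monoid)
      = q ^ k * (q ^ k + (q ^ k - 1) * q) / (q ^ 3) ^ k"
    by (simp add: commuting_prob_def card_commuting_tuples_UT_3 order_UT_3 q)
  also have "q ^ k * (q ^ k + (q ^ k - 1) * q) = (q ^ k + q ^ (k - 1) - 1) * q ^ Suc k"
    by (simp add: k algebra_simps)
  also have "(q ^ 3) ^ k = q ^ (2 * k - 1) * q ^ Suc k"
  proof -
    have "3 * k = (2 * k - 1) + Suc k" using assms(1) by simp
    then show ?thesis by (metis power_add power_mult)
  qed
  finally show ?thesis using \<open>q \<noteq> 0\<close> by simp
qed

theorem mainTheorem6:
  fixes q :: nat and G :: "'a :: {field, finite} mat monoid"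
  assumes "primepow q" and "odd q"
    and "CARD('a) = q"
    and "G = UT 3"
  shows "commuting_prob 2 G = (real q ^ 2 + real q - 1) / real q ^ 3
    \<and> commuting_prob 3 G = (real q ^ 3 + real q ^ 2 - 1) / real q ^ 5
    \<and> commuting_prob 4 G = (real q ^ 4 + real q ^ 3 - 1) / real q ^ 7
    \<and> commuting_prob 5 G = (real q ^ 5 + real q ^ 4 - 1) / real q ^ 9"
  using assms(3,4) by (simp add: commuting_prob_UT_3[OF _ refl])

end
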